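(* Let $X$ be an infinite compact Hausdorff space, and suppose that $X$ satisfies one of the following conditions: (1) $X$ has the countable chain condition; (2) $X$ is separable; (3) $X$ is metrizable; (4) $X$ is homeomorphic to a product of two infinite compact Hausdorff spaces; (5) $X$ is not sub-Stonean; (6) $X$ is Rickart. Then $C(X)$ is not countably degree-$1$ saturated.
   Context: $C(X)$ is the C*-algebra of continuous complex-valued functions on $X$. $X$ has the countable chain condition if every collection of pairwise disjoint nonempty open subsets of $X$ is countable. $X$ is sub-Stonean if any two disjoint open $\sigma$-compact subsets of $X$ have disjoint closures; if, in addition, those closures are open and compact, $X$ is Rickart. For compact $K\subseteq\mathbb{R}$ and $\epsilon>0$, $(K)_\epsilon=\{x\in\mathbb{R} : d(x,K)<\epsilon\}$. For a C*-algebra $A$, $A_{\le 1}$ is its closed unit ball. A degree-$1$ $*$-polynomial over $A$ in variables $x_0,x_1,\dots$ is a finite sum of terms $a x_k b$, $a x_k^* b$ and $a$, with $a,b$ in $A$ or scalars. $A$ is countably degree-$1$ saturated if for every sequence $(P_n)_{n\in\mathbb{N}}$ of degree-$1$ $*$-polynomials over $A$ in the variables $(x_k)_{k\in\mathbb{N}}$ and every sequence $(K_n)_{n\in\mathbb{N}}$ of compact subsets of $\mathbb{R}$ the following are equivalent: (i) there is a sequence $\bar b=(b_k)_{k\in\mathbb{N}}$ in $A_{\le 1}$ with $\|P_n(\bar b)\|\in K_n$ for all $n$; (ii) for every $\epsilon>0$ and every finite $\Delta\subset\mathbb{N}$ there is a sequence $\bar b=(b_k)_{k\in\mathbb{N}}$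 in $A_{\le 1}$ with $\|P_n(\bar b)\|\in (K_n)_\epsilon$ for all $n\in\Delta$. *)

theory Defs
  imports "HOL-Analysis.Analysis" "HOL-Algebra.Module"
begin

definition ccc_space :: "'a topology \<Rightarrow> bool" where
  "ccc_space X \<longleftrightarrow>
     (\<forall>\<U>. (\<forall>U\<in>\<U>. openin X U \<and> U \<noteq> {}) \<and> pairwise disjnt \<U> \<longrightarrow> countable \<U>)"

definition sigma_compactin :: "'a topology \<Rightarrow> 'a set \<Rightarrow> bool" where
  "sigma_compactin X S \<longleftrightarrow> (\<exists>\<K>. countable \<K> \<and> (\<forall>K\<in>\<K>. compactin X K) \<and> S = \<Union>\<K>)"

definition sub_Stonean_space :: "'a topology \<Rightarrow> bool" where
  "sub_Stonean_space X \<longleftrightarrow>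
     (\<forall>U V. openin X U \<and> sigma_compactin X U \<and> openin X V \<and> sigma_compactin X V \<and> disjnt U V
        \<longrightarrow> disjnt (X closure_of U) (X closure_of V))"

definition Rickart_space :: "'a topology \<Rightarrow> bool" where
  "Rickart_space X \<longleftrightarrow> sub_Stonean_space X \<and>
     (\<forall>U V. openin X U \<and> sigma_compactin X U \<and> openin X V \<and> sigma_compactin X V \<and> disjnt U V
        \<longrightarrow> openin X (X closure_of U) \<and> compactin X (X closure_of U) \<and>
            openin X (X closure_of V) \<and> compactin X (X closure_of V))"

text \<open>
  The operations of a unital C*-algebra, as a record on an explicit carrier, so that \<open>C(X)\<close> can be
  formed for a topology on an arbitrary carrier set.  As usual for such records, the definitions below
  are meant for structures that do satisfy the C*-algebra axioms.
\<close>

record 'a cstar_struct = "(complex, 'a) module" +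
  star :: "'a \<Rightarrow> 'a"
  cnorm :: "'a \<Rightarrow> real"

definition C_algebra :: "'a topology \<Rightarrow> ('a \<Rightarrow> complex) cstar_struct" where
  "C_algebra X =
    \<lparr> carrier = {f \<in> extensional (topspace X). continuous_map X euclidean f},
      monoid.mult = (\<lambda>f g. \<lambda>x\<in>topspace X. f x * g x),
      one = (\<lambda>x\<in>topspace X. 1),
      zero = (\<lambda>x\<in>topspace X. 0),
      add = (\<lambda>f g. \<lambda>x\<in>topspace X. f x + g x),
      smult = (\<lambda>c f. \<lambda>x\<in>topspace X. c * f x),
      star = (\<lambda>f. \<lambda>x\<in>topspace X. cnj (f x)),
      cnorm = (\<lambda>f. SUP x\<in>topspace X. cmod (f x)) \<rparr>"

definition cunit_ball :: "('a, 'm) cstar_struct_scheme \<Rightarrow> 'a set" where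
  "cunit_ball A = {a \<in> carrier A. cnorm A a \<le> 1}"

text \<open>
  \<open>VarTerm a k b\<close>, \<open>StarTerm a k b\<close> and \<open>ConstTerm a\<close> stand for \<open>a x\<^sub>k b\<close>, \<open>a x\<^sub>k\<^sup>* b\<close> and \<open>a\<close>;
  a degree-1 *-polynomial is a finite formal sum, i.e. a list, of such terms.  A scalar \<open>c\<close> occurring
  as a coefficient is the element \<open>c \<odot> \<one>\<close> of the algebra.
\<close>

datatype 'a deg1_term = VarTerm 'a nat 'a | StarTerm 'a nat 'a | ConstTerm 'a

type_synonym 'a deg1_poly = "'a deg1_term list"

definition deg1_coeffs :: "('a, 'm) cstar_struct_scheme \<Rightarrow> 'a set" where
  "deg1_coeffs A = carrier A \<union> range (\<lambda>c::complex. c \<odot>\<^bsub>A\<^esub> \<one>\<^bsub>A\<^esub>)"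

definition deg1_polys :: "('a, 'm) cstar_struct_scheme \<Rightarrow> 'a deg1_poly set" where
  "deg1_polys A = {p. \<forall>t\<in>set p. set_deg1_term t \<subseteq> deg1_coeffs A}"

fun eval_deg1_term :: "('a, 'm) cstar_struct_scheme \<Rightarrow> (nat \<Rightarrow> 'a) \<Rightarrow> 'a deg1_term \<Rightarrow> 'a" where
  "eval_deg1_term A x (VarTerm a k b) = a \<otimes>\<^bsub>A\<^esub> x k \<otimes>\<^bsub>A\<^esub> b"
| "eval_deg1_term A x (StarTerm a k b) = a \<otimes>\<^bsub>A\<^esub> star A (x k) \<otimes>\<^bsub>A\<^esub> b"
| "eval_deg1_term A x (ConstTerm a) = a"

definition eval_deg1_poly :: "('a, 'm) cstar_struct_scheme \<Rightarrow> (nat \<Rightarrow> 'a) \<Rightarrow> 'a deg1_poly \<Rightarrow> 'a" where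
  "eval_deg1_poly A x p = foldr (\<lambda>t s. eval_deg1_term A x t \<oplus>\<^bsub>A\<^esub> s) p \<zero>\<^bsub>A\<^esub>"

text \<open>
  The distance to the empty set is infinite by convention, whereas \<open>infdist x {} = 0\<close>.
\<close>

definition open_nbhd :: "real set \<Rightarrow> real \<Rightarrow> real set" where
  "open_nbhd K \<epsilon> = {x. K \<noteq> {} \<and> infdist x K < \<epsilon>}"

definition countably_degree1_saturated :: "('a, 'm) cstar_struct_scheme \<Rightarrow> bool" where
  "countably_degree1_saturated A \<longleftrightarrow>
     (\<forall>(P :: nat \<Rightarrow> 'a deg1_poly) (K :: nat \<Rightarrow> real set).
        (\<forall>n. P n \<in> deg1_polys A) \<and> (\<forall>n. compact (K n)) \<longrightarrow>
        ((\<exists>b :: nat \<Rightarrow> 'a. (\<forall>k. b k \<in> cunit_ball A) \<and>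
             (\<forall>n. cnorm A (eval_deg1_poly A b (P n)) \<in> K n))
         \<longleftrightarrow>
         (\<forall>\<epsilon>>0. \<forall>\<Delta> :: nat set. finite \<Delta> \<longrightarrow>
             (\<exists>b :: nat \<Rightarrow> 'a. (\<forall>k. b k \<in> cunit_ball A) \<and>
                (\<forall>n\<in>\<Delta>. cnorm A (eval_deg1_poly A b (P n)) \<in> open_nbhd (K n) \<epsilon>)))))"

end

theory Submission
  imports Defs
begin

text \<open>
  Degree-1 conditions can express multiplication by a fixed function, and this suffices to control
  how cozero sets \<open>{f > 0}\<close>, with \<open>f \<ge> 0\<close> continuous, sit in a compact space \<open>X\<close> whose algebra
  \<open>C(X)\<close> is saturated.  Two properties are extracted.

  First, a proper cozero set \<open>{f > 0}\<close> is never dense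
  (\<open>degree1_saturated_imp_not_dense\<close>).  As \<open>f\<close> has a zero, the function
  \<open>max 0 (1 - c f)\<close> has norm 1, and its product with \<open>f\<close> is as small as desired when \<open>c\<close> is
  large.  So the conditions \<open>\<parallel>h\<parallel> = 1\<close> and \<open>\<parallel>f h\<parallel> = 0\<close> are approximately satisfiable; an exact
  solution \<open>h\<close> is nonzero on a nonempty open set that misses \<open>{f > 0}\<close>.

  Second, disjoint cozero sets \<open>{f > 0}\<close> and \<open>{g > 0}\<close> have disjoint closures
  (\<open>degree1_saturated_imp_disjnt_closures\<close>).  The functions \<open>min 1 (c g)\<close> solve \<open>\<parallel>f h\<parallel> = 0\<close>
  and approximately \<open>\<parallel>g h - g\<parallel> = 0\<close>; an exact solution \<open>h\<close> is 0 on one closure and 1 on the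
  other.

  In a compact Hausdorff space the open \<open>\<sigma>\<close>-compact sets are exactly the cozero sets, by Urysohn's
  lemma, so the second property says that \<open>X\<close> is sub-Stonean.  Each of the remaining conditions
  produces a cozero set, or a pair of them, that contradicts one of the two properties.  Let
  \<open>x\<close> be a point that is not isolated.

  If \<open>X\<close> has the countable chain condition, a maximal disjoint family of nonempty cozero sets that
  avoid \<open>x\<close> is countable; its union is a proper dense cozero set.  Separable spaces satisfy the
  countable chain condition.  If \<open>X\<close> is metrizable, the complement of \<open>x\<close> is itself a proper dense
  cozero set.

  An infinite compact Hausdorff space always has a cozero set \<open>U\<close> that is not closed
  (\<open>nonclosed_cozero_in_exists\<close>).  If \<open>X\<close> is Rickart, the closure of \<open>U\<close> is open, and adding to
  \<open>U\<close> the complement of its closure gives a proper dense cozero set.  If \<open>X\<close> is a product, take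
  such sets \<open>{f > 0}\<close> and \<open>{g > 0}\<close> in the two factors, with boundary points \<open>p\<close> and \<open>q\<close>.  Then
  \<open>{(y, z). f y > g z}\<close> and \<open>{(y, z). f y < g z}\<close> are disjoint cozero sets, and \<open>(p, q)\<close> lies in
  both closures: in the first by moving \<open>y\<close> near \<open>p\<close> with \<open>z = q\<close>, in the second by moving \<open>z\<close>
  near \<open>q\<close> with \<open>y = p\<close>.
\<close>

section \<open>Cozero sets\<close>

text \<open>
  The function \<open>f\<close> may be negative off \<open>U\<close>, so that sets such as \<open>{g > h}\<close> qualify with \<open>f = g - h\<close>;
  replacing \<open>f\<close> by its positive part gives the usual form, the complement of a zero set.
\<close>

definition cozero_in :: "'a topology \<Rightarrow> 'a set \<Rightarrow> bool" where
  "cozero_in X U \<longleftrightarrow>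
     (\<exists>f. continuous_map X euclideanreal f \<and> U = {x \<in> topspace X. 0 < f x})"

lemma cozero_in_nonneg:
  assumes "cozero_in X U"
  obtains f where "continuous_map X euclideanreal f" "\<And>x. 0 \<le> f x"
    "U = {x \<in> topspace X. 0 < f x}"
proof -
  obtain g where g: "continuous_map X euclideanreal g" "U = {x \<in> topspace X. 0 < g x}"
    using assms unfolding cozero_in_def by blast
  show ?thesis
  proof
    show "continuous_map X euclideanreal (\<lambda>x. max (g x) 0)"
      by (intro continuous_map_real_max g) auto
  qed (auto simp: g)
qed

lemma openin_cozero_in: "cozero_in X U \<Longrightarrow> openin X U"
proof -
  assume "cozero_in X U"
  then obtain f where f: "continuous_map X euclideanreal f" "U = {x \<in> topspace X. f x \<in> {0<..}}"
    unfolding cozero_in_def by auto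
  show ?thesis
    unfolding f(2) by (rule openin_continuous_map_preimage[OF f(1)]) (simp add: open_openin[symmetric])
qed

lemma cozero_in_sigma_compactin:
  assumes "compact_space X" "cozero_in X U"
  shows "sigma_compactin X U"
proof -
  obtain f where f: "continuous_map X euclideanreal f" "U = {x \<in> topspace X. 0 < f x}"
    using assms unfolding cozero_in_def by blast
  define K where "K n = {x \<in> topspace X. f x \<in> {inverse (real (Suc n))..}}" for n
  have "compactin X (K n)" for n
    unfolding K_def
    by (intro closedin_compact_space assms closedin_continuous_map_preimage[OF f(1)]) simp
  moreover have "U = \<Union>(range K)"
  proof -
    have "\<exists>n. inverse (real (Suc n)) \<le> t" if "0 < t" for t :: real
      using reals_Archimedean[OF that] less_imp_le by blast
    moreover have "0 < t" if "inverse (real (Suc n)) \<le> t" for t n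
      using that by (meson inverse_positive_iff_positive less_le_trans of_nat_0_less_iff zero_less_Suc)
    ultimately show ?thesis
      unfolding f(2) K_def by (auto)
  qed
  ultimately show ?thesis
    unfolding sigma_compactin_def by (intro exI[of _ "range K"]) auto
qed

text \<open>
  This is Urysohn's lemma for \<open>K\<close> and the complement of \<open>U\<close>.
\<close>

lemma cozero_in_between:
  assumes "compact_space X" "Hausdorff_space X" "closedin X K" "openin X U" "K \<subseteq> U"
  obtains C where "cozero_in X C" "K \<subseteq> C" "C \<subseteq> U"
proof -
  have "normal_space X"
    using assms by (simp add: compact_Hausdorff_or_regular_imp_normal_space)
  moreover have "closedin X (topspace X - U)" "disjnt (topspace X - U) K"
    using assms by (auto simp: disjnt_iff)
  ultimately obtain f where f: "continuous_map X euclideanreal f"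
    "f ` (topspace X - U) \<subseteq> {0}" "f ` K \<subseteq> {1}"
    using Urysohn_lemma_alt assms(3) by metis
  show ?thesis
  proof
    show "cozero_in X {x \<in> topspace X. 0 < f x}"
      using f(1) unfolding cozero_in_def by blast
    show "K \<subseteq> {x \<in> topspace X. 0 < f x}"
      using f(3) closedin_subset[OF assms(3)] by force
    show "{x \<in> topspace X. 0 < f x} \<subseteq> U"
      using f(2) by force
  qed
qed

text \<open>
  Instead of summing a series, combine functions \<open>f\<^sub>n \<ge> 0\<close> that define the countably many sets into one
  map to the sequence space \<open>nat \<Rightarrow> real\<close>.  That space is metrizable, and the distance to the zero
  sequence is positive exactly where some \<open>f\<^sub>n\<close> is.
\<close>

lemma cozero_in_Union:
  assumes "countable \<U>" "\<And>U. U \<in> \<U> \<Longrightarrow> cozero_in X U"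
  shows "cozero_in X (\<Union>\<U>)"
proof (cases "\<U> = {}")
  case True
  then show ?thesis
    unfolding cozero_in_def by (intro exI[of _ "\<lambda>_. 0"]) auto
next
  case False
  then obtain U where U: "\<U> = range (U :: nat \<Rightarrow> _)"
    using assms(1) uncountable_def by metis
  have "\<exists>f. continuous_map X euclideanreal f \<and> (\<forall>x. 0 \<le> f x) \<and> U n = {x \<in> topspace X. 0 < f x}"
    for n
  proof -
    have "cozero_in X (U n)"
      using assms(2) U by blast
    then obtain f where "continuous_map X euclideanreal f" "\<And>x. 0 \<le> f x"
      "U n = {x \<in> topspace X. 0 < f x}"
      by (rule cozero_in_nonneg) blast
    then show ?thesis
      by blast
  qed
  then obtain f where f: "\<And>n. continuous_map X euclideanreal (f n)" "\<And>n x. 0 \<le> f n x"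
    "\<And>n. U n = {x \<in> topspace X. 0 < f n x}"
    by metis
  define F where "F x = (\<lambda>n. f n x)" for x
  have "continuous_map X euclidean F"
    using f(1) by (simp add: F_def euclidean_product_topology[symmetric] continuous_map_componentwise_UNIV)
  moreover have "continuous_map euclidean euclideanreal (\<lambda>a. dist a (\<lambda>n::nat. 0::real))"
    by (simp add: continuous_on_dist)
  ultimately have "continuous_map X euclideanreal (\<lambda>x. dist (F x) (\<lambda>n. 0))"
    using continuous_map_compose[of X euclidean F euclideanreal] by (auto simp: o_def)
  moreover have "\<Union>\<U> = {x \<in> topspace X. 0 < dist (F x) (\<lambda>n. 0)}"
  proof -
    have "(\<exists>n. 0 < f n x) \<longleftrightarrow> F x \<noteq> (\<lambda>n. 0)" for x
      using f(2)[of _ x] by (auto simp: F_def fun_eq_iff less_le)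
    then show ?thesis
      unfolding U zero_less_dist_iff by (auto simp: f(3))
  qed
  ultimately show ?thesis
    unfolding cozero_in_def by blast
qed

lemma cozero_in_Un: "cozero_in X U \<Longrightarrow> cozero_in X V \<Longrightarrow> cozero_in X (U \<union> V)"
  using cozero_in_Union[of "{U, V}" X] by auto

lemma sigma_compactin_imp_cozero_in:
  assumes X: "compact_space X" "Hausdorff_space X"
    and U: "openin X U" "sigma_compactin X U"
  shows "cozero_in X U"
proof -
  obtain \<K> where \<K>: "countable \<K>" "\<And>K. K \<in> \<K> \<Longrightarrow> compactin X K" "U = \<Union>\<K>"
    using U(2) unfolding sigma_compactin_def by blast
  have "\<exists>C. cozero_in X C \<and> K \<subseteq> C \<and> C \<subseteq> U" if "K \<in> \<K>" for K
  proof -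
    have "closedin X K" "K \<subseteq> U"
      using \<K> that X(2) by (auto intro: compactin_imp_closedin)
    then show ?thesis
      using cozero_in_between[OF X _ U(1)] by metis
  qed
  then obtain C where C: "\<And>K. K \<in> \<K> \<Longrightarrow> cozero_in X (C K) \<and> K \<subseteq> C K \<and> C K \<subseteq> U"
    by metis
  then have "U = \<Union>(C ` \<K>)"
    using \<K>(3) by blast
  then show ?thesis
    using cozero_in_Union[of "C ` \<K>" X] \<K>(1) C by auto
qed

text \<open>
  An accumulation point \<open>p\<close> of a countable infinite set can be avoided by a cozero neighbourhood of
  each of the other points.  Their union is still cozero, and it accumulates at \<open>p\<close>.
\<close>

lemma nonclosed_cozero_in_exists:
  assumes X: "compact_space X" "Hausdorff_space X" "infinite (topspace X)"
  obtains U p where "cozero_in X U" "p \<in> X closure_of U" "p \<notin> U"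
proof -
  obtain S where S: "S \<subseteq> topspace X" "infinite S" "countable S"
    using infinite_countable_subset'[OF X(3)] by blast
  obtain p where p: "p \<in> X derived_set_of S"
    using compact_space_imp_Bolzano_Weierstrass[OF X(1) S(2,1)] by blast
  have "\<exists>C. cozero_in X C \<and> s \<in> C \<and> p \<notin> C" if "s \<in> S - {p}" for s
  proof -
    have "s \<in> topspace X" "p \<in> topspace X"
      using that S(1) p by (auto simp: in_derived_set_of)
    then have "closedin X {s}" "openin X (topspace X - {p})" "{s} \<subseteq> topspace X - {p}"
      using that X(2) by (auto simp: closedin_Hausdorff_sing_eq)
    then obtain C where "cozero_in X C" "{s} \<subseteq> C" "C \<subseteq> topspace X - {p}"
      using cozero_in_between[OF X(1,2)] by metis
    then show ?thesis
      by blast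
  qed
  then obtain C where C: "\<And>s. s \<in> S - {p} \<Longrightarrow> cozero_in X (C s) \<and> s \<in> C s \<and> p \<notin> C s"
    by metis
  let ?U = "\<Union>(C ` (S - {p}))"
  show ?thesis
  proof
    show "cozero_in X ?U"
      using S(3) C by (intro cozero_in_Union) auto
    have sub: "S - {p} \<subseteq> ?U"
      using C by blast
    show "p \<in> X closure_of ?U"
      unfolding in_closure_of
    proof (intro conjI allI impI)
      show "p \<in> topspace X"
        using p by (simp add: in_derived_set_of)
      fix T assume "p \<in> T \<and> openin X T"
      then obtain y where "y \<noteq> p" "y \<in> S" "y \<in> T"
        using p unfolding in_derived_set_of by metis
      then show "\<exists>y. y \<in> ?U \<and> y \<in> T"
        using sub by blast
    qed
    show "p \<notin> ?U"
      using C by blast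
  qed
qed

lemma nonisolated_point_exists:
  assumes "compact_space X" "infinite (topspace X)"
  obtains p where "p \<in> topspace X" "\<not> openin X {p}"
proof -
  obtain p where "p \<in> X derived_set_of topspace X"
    using compact_space_imp_Bolzano_Weierstrass[OF assms] by blast
  then show ?thesis
    using that by (metis in_derived_set_of singletonD singletonI)
qed

section \<open>Cozero sets over a saturated algebra\<close>

abbreviation sup_norm :: "'a topology \<Rightarrow> ('a \<Rightarrow> complex) \<Rightarrow> real" where
  "sup_norm X f \<equiv> SUP x\<in>topspace X. cmod (f x)"

lemma bdd_above_cmod_continuous_map:
  assumes "compact_space X" "continuous_map X euclidean f"
  shows "bdd_above ((\<lambda>x. cmod (f x)) ` topspace X)"
proof -
  have "compactin euclidean (f ` topspace X)"
    using assms unfolding compact_space_def by (rule image_compactin)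
  then have "bounded (f ` topspace X)"
    by (simp add: compact_imp_bounded)
  then show ?thesis
    unfolding bounded_iff by (auto intro: bdd_aboveI2)
qed

lemma cmod_le_sup_norm:
  assumes "compact_space X" "continuous_map X euclidean f" "x \<in> topspace X"
  shows "cmod (f x) \<le> sup_norm X f"
  using cSUP_upper[OF assms(3) bdd_above_cmod_continuous_map[OF assms(1,2)]] .

text \<open>
  The conditions have the form \<open>\<parallel>F h + G\<parallel> = r\<close>, with one unknown \<open>h\<close>; two of them suffice for all
  the uses of saturation below.  To match the indexing by all natural numbers, the second condition is
  repeated infinitely often, and every variable is interpreted by the same function.
\<close>

lemma degree1_saturated_realizes_two_conditions:
  fixes F G F' G' :: "'a \<Rightarrow> complex"
  assumes sat: "countably_degree1_saturated (C_algebra X)"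
    and X: "compact_space X" "topspace X \<noteq> {}"
    and cont: "continuous_map X euclidean F" "continuous_map X euclidean G"
      "continuous_map X euclidean F'" "continuous_map X euclidean G'"
    and approx: "\<And>\<epsilon>. \<epsilon> > 0 \<Longrightarrow> \<exists>h. continuous_map X euclidean h \<and>
        (\<forall>x\<in>topspace X. cmod (h x) \<le> 1) \<and>
        \<bar>sup_norm X (\<lambda>x. F x * h x + G x) - r\<bar> < \<epsilon> \<and>
        \<bar>sup_norm X (\<lambda>x. F' x * h x + G' x) - r'\<bar> < \<epsilon>"
  obtains h where "continuous_map X euclidean h"
    "sup_norm X (\<lambda>x. F x * h x + G x) = r" "sup_norm X (\<lambda>x. F' x * h x + G' x) = r'"
proof -
  let ?A = "C_algebra X" and ?R = "\<lambda>f. restrict f (topspace X)"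
  have restr: "?R f \<in> carrier ?A" if "continuous_map X euclidean f" for f
    using that by (auto simp: C_algebra_def intro: continuous_map_eq)
  define p where "p f g = [VarTerm (?R f) 0 \<one>\<^bsub>?A\<^esub>, ConstTerm (?R g)]" for f g
  have one: "\<one>\<^bsub>?A\<^esub> \<in> carrier ?A"
    using restr[of "\<lambda>_. 1"] by (simp add: C_algebra_def)
  have p_poly: "p f g \<in> deg1_polys ?A"
    if "continuous_map X euclidean f" "continuous_map X euclidean g" for f g
    using restr[OF that(1)] restr[OF that(2)] one by (auto simp: p_def deg1_polys_def deg1_coeffs_def)
  have norm_p: "cnorm ?A (eval_deg1_poly ?A b (p f g)) = sup_norm X (\<lambda>x. f x * b 0 x + g x)"
    for b f g
    by (simp add: p_def eval_deg1_poly_def C_algebra_def cong: SUP_cong_simp)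
  define P where "P n = (if n = 0 then p F G else p F' G')" for n :: nat
  define K where "K n = (if n = 0 then {r} else {r'})" for n :: nat
  have "\<exists>b. (\<forall>k. b k \<in> cunit_ball ?A) \<and> (\<forall>n\<in>\<Delta>. cnorm ?A (eval_deg1_poly ?A b (P n)) \<in> open_nbhd (K n) \<epsilon>)"
    if pos: "\<epsilon> > 0" for \<epsilon> and \<Delta> :: "nat set"
  proof -
    obtain h where h: "continuous_map X euclidean h" "\<forall>x\<in>topspace X. cmod (h x) \<le> 1"
      and near: "\<bar>sup_norm X (\<lambda>x. F x * h x + G x) - r\<bar> < \<epsilon>"
        "\<bar>sup_norm X (\<lambda>x. F' x * h x + G' x) - r'\<bar> < \<epsilon>"
      using approx[OF pos] by blast
    have "cnorm ?A (?R h) \<le> 1"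
      using X(2) h(2) by (auto simp: C_algebra_def intro!: cSUP_least)
    then have "?R h \<in> cunit_ball ?A"
      using restr[OF h(1)] by (simp add: cunit_ball_def)
    moreover have "sup_norm X (\<lambda>x. f x * ?R h x + g x) = sup_norm X (\<lambda>x. f x * h x + g x)" for f g
      by (simp cong: SUP_cong_simp)
    ultimately show ?thesis
      using near by (intro exI[of _ "\<lambda>_. ?R h"])
        (simp add: P_def K_def norm_p open_nbhd_def dist_real_def)
  qed
  moreover have "\<forall>n. P n \<in> deg1_polys ?A" "\<forall>n. compact (K n)"
    using p_poly cont by (auto simp: P_def K_def)
  ultimately obtain b where b: "\<forall>k. b k \<in> cunit_ball ?A"
    "\<forall>n. cnorm ?A (eval_deg1_poly ?A b (P n)) \<in> K n"
    using sat unfolding countably_degree1_saturated_def by (metis (no_types, lifting))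
  show ?thesis
  proof
    show "continuous_map X euclidean (b 0)"
      using b(1) by (auto simp: cunit_ball_def C_algebra_def)
    show "sup_norm X (\<lambda>x. F x * b 0 x + G x) = r"
      using b(2)[rule_format, of 0] by (simp add: P_def K_def norm_p)
    show "sup_norm X (\<lambda>x. F' x * b 0 x + G' x) = r'"
      using b(2)[rule_format, of 1] by (simp add: P_def K_def norm_p)
  qed
qed

lemma continuous_map_complex_of_real:
  "continuous_map X euclideanreal f \<Longrightarrow> continuous_map X euclidean (\<lambda>x. complex_of_real (f x))"
  using continuous_map_compose[of X euclideanreal f euclidean complex_of_real]
  by (simp add: o_def)

lemma continuous_map_complex_mult_add:
  fixes f g h :: "'a \<Rightarrow> complex"
  assumes "continuous_map X euclidean f" "continuous_map X euclidean g" "continuous_map X euclidean h"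
  shows "continuous_map X euclidean (\<lambda>x. f x * g x + h x)"
proof -
  have "continuous_map X euclidean (\<lambda>x. (f x, g x, h x))" (is "continuous_map _ _ ?t")
    unfolding prod_topology_euclidean[symmetric] by (intro continuous_map_pairedI assms)
  moreover have "continuous_map euclidean euclidean (\<lambda>(a, b, c). a * b + c :: complex)"
    by (simp add: case_prod_unfold) (intro continuous_intros)
  ultimately have "continuous_map X euclidean ((\<lambda>(a, b, c). a * b + c) \<circ> ?t)"
    by (rule continuous_map_compose)
  then show ?thesis
    by (simp add: o_def)
qed

text \<open>
  The conditions are \<open>\<parallel>h\<parallel> = 1\<close> and \<open>\<parallel>f h\<parallel> = 0\<close>, where \<open>U = {f > 0}\<close>.
\<close>

lemma degree1_saturated_imp_not_dense:
  assumes sat: "countably_degree1_saturated (C_algebra X)"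
    and X: "compact_space X" and U: "cozero_in X U" "U \<noteq> topspace X"
  obtains W where "openin X W" "W \<noteq> {}" "disjnt U W"
proof -
  obtain f where f: "continuous_map X euclideanreal f" "\<And>x. 0 \<le> f x"
    and U_eq: "U = {x \<in> topspace X. 0 < f x}"
    using cozero_in_nonneg[OF U(1)] by metis
  obtain p where p: "p \<in> topspace X" "f p = 0"
    using U(2) f(2) unfolding U_eq by (metis (mono_tags, lifting) Collect_cong Collect_mem_eq order.strict_iff_order)
  have ne: "topspace X \<noteq> {}"
    using p by blast
  have "\<exists>h. continuous_map X euclidean h \<and> (\<forall>x\<in>topspace X. cmod (h x) \<le> 1) \<and>
        \<bar>sup_norm X (\<lambda>x. 1 * h x + 0) - 1\<bar> < \<epsilon> \<and> \<bar>sup_norm X (\<lambda>x. of_real (f x) * h x + 0) - 0\<bar> < \<epsilon>"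
    if "\<epsilon> > 0" for \<epsilon>
  proof -
    \<comment> \<open>The slope \<open>2 / \<epsilon>\<close> makes \<open>g\<close> vanish once \<open>f\<close> exceeds \<open>\<epsilon> / 2\<close>, which bounds the product
      by \<open>\<epsilon> / 2\<close> and leaves room for the strict inequality.\<close>
    define g where "g x = max 0 (1 - 2 / \<epsilon> * f x)" for x
    have g: "continuous_map X euclideanreal g"
      unfolding g_def by (intro continuous_intros f(1)) auto
    have g01: "0 \<le> g x" "g x \<le> 1" for x
      using f(2)[of x] that by (auto simp: g_def)
    have "sup_norm X (\<lambda>x. of_real (g x)) = 1"
    proof (rule cSup_eq_maximum)
      show "1 \<in> (\<lambda>x. cmod (of_real (g x))) ` topspace X"
        using p by (intro image_eqI[of _ _ p]) (auto simp: g_def)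
    qed (use g01 in auto)
    moreover have small: "cmod (of_real (f x) * of_real (g x)) \<le> \<epsilon> / 2" for x
    proof (cases "f x \<le> \<epsilon> / 2")
      case True
      then have "f x * g x \<le> \<epsilon> / 2 * 1"
        using f(2) g01 that by (intro mult_mono) auto
      then show ?thesis
        using f(2) g01 by (simp add: norm_mult)
    next
      case False
      then have "g x = 0"
        using that by (simp add: g_def field_simps)
      then show ?thesis
        using that by simp
    qed
    have "sup_norm X (\<lambda>x. of_real (f x) * of_real (g x)) \<le> \<epsilon> / 2"
      by (rule cSUP_least[OF ne]) (rule small)
    moreover have "0 \<le> sup_norm X (\<lambda>x. of_real (f x) * of_real (g x))"
      using small by (intro cSUP_upper2[OF _ p(1)] bdd_aboveI2[where M = "\<epsilon> / 2"]) auto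
    ultimately show ?thesis
      using that g01 continuous_map_complex_of_real[OF g]
      by (intro exI[of _ "\<lambda>x. of_real (g x)"]) auto
  qed
  then obtain h where h: "continuous_map X euclidean h"
    "sup_norm X (\<lambda>x. 1 * h x + 0) = 1" "sup_norm X (\<lambda>x. of_real (f x) * h x + 0) = 0"
    using degree1_saturated_realizes_two_conditions[OF sat X ne, of "\<lambda>_. 1" "\<lambda>_. 0" "\<lambda>x. of_real (f x)" "\<lambda>_. 0" 1 0]
      continuous_map_complex_of_real[OF f(1)] by auto
  let ?W = "{x \<in> topspace X. h x \<in> - {0}}"
  show ?thesis
  proof
    show "openin X ?W"
      by (rule openin_continuous_map_preimage[OF h(1)]) (auto intro: open_Compl)
    show "?W \<noteq> {}"
    proof
      assume "?W = {}"
      then have "sup_norm X (\<lambda>x. 1 * h x + 0) = (SUP x\<in>topspace X. 0)"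
        by (intro SUP_cong) auto
      also have "\<dots> = 0"
        by (rule cSUP_const[OF ne])
      finally show False
        using h(2) by simp
    qed
    have "continuous_map X euclidean (\<lambda>x. of_real (f x) * h x + 0)"
      by (intro continuous_map_complex_mult_add h continuous_map_complex_of_real f) auto
    then have "of_real (f x) * h x = 0" if "x \<in> topspace X" for x
      using cmod_le_sup_norm[OF X _ that] h(3) by fastforce
    then show "disjnt U ?W"
      by (force simp: U_eq disjnt_iff)
  qed
qed

text \<open>
  The conditions are \<open>\<parallel>f h\<parallel> = 0\<close> and \<open>\<parallel>g h - g\<parallel> = 0\<close>, where \<open>U = {f > 0}\<close> and \<open>V = {g > 0}\<close>.  They
  force \<open>h\<close> to be 0 on the closure of \<open>U\<close> and 1 on the closure of \<open>V\<close>.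
\<close>

lemma degree1_saturated_imp_disjnt_closures:
  assumes sat: "countably_degree1_saturated (C_algebra X)"
    and X: "compact_space X" and U: "cozero_in X U" and V: "cozero_in X V" and disj: "disjnt U V"
  shows "disjnt (X closure_of U) (X closure_of V)"
proof (cases "topspace X = {}")
  case True
  then show ?thesis
    using closure_of_subset_topspace[of X U] by auto
next
  case ne: False
  obtain f where f: "continuous_map X euclideanreal f" "\<And>x. 0 \<le> f x"
    and U_eq: "U = {x \<in> topspace X. 0 < f x}"
    using cozero_in_nonneg[OF U] by metis
  obtain g where g: "continuous_map X euclideanreal g" "\<And>x. 0 \<le> g x"
    and V_eq: "V = {x \<in> topspace X. 0 < g x}"
    using cozero_in_nonneg[OF V] by metis
  have fg: "f x = 0 \<or> g x = 0" if "x \<in> topspace X" for x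
    using disj that f(2)[of x] g(2)[of x] by (force simp: U_eq V_eq disjnt_iff)
  note F = continuous_map_complex_of_real[OF f(1)] and G = continuous_map_complex_of_real[OF g(1)]
  have G': "continuous_map X euclidean (\<lambda>x. - complex_of_real (g x))"
    using continuous_map_complex_of_real[OF continuous_map_minus[OF g(1)]] by simp
  have "\<exists>h. continuous_map X euclidean h \<and> (\<forall>x\<in>topspace X. cmod (h x) \<le> 1) \<and>
        \<bar>sup_norm X (\<lambda>x. of_real (f x) * h x + 0) - 0\<bar> < \<epsilon> \<and>
        \<bar>sup_norm X (\<lambda>x. of_real (g x) * h x + - of_real (g x)) - 0\<bar> < \<epsilon>"
    if "\<epsilon> > 0" for \<epsilon>
  proof -
    \<comment> \<open>\<open>h\<close> vanishes with \<open>g\<close>, in particular where \<open>f\<close> is positive, and it can differ from 1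
      only where \<open>g\<close> is at most \<open>\<epsilon> / 2\<close>.\<close>
    define h where "h x = min 1 (2 / \<epsilon> * g x)" for x
    have h: "continuous_map X euclideanreal h"
      unfolding h_def by (intro continuous_intros g(1)) auto
    have h01: "0 \<le> h x" "h x \<le> 1" for x
      using g(2)[of x] that by (auto simp: h_def)
    have "of_real (f x) * complex_of_real (h x) = 0" if "x \<in> topspace X" for x
      using fg[OF that] by (auto simp: h_def)
    then have "sup_norm X (\<lambda>x. of_real (f x) * of_real (h x) + 0) = (SUP x\<in>topspace X. 0)"
      by (intro SUP_cong) auto
    then have "sup_norm X (\<lambda>x. of_real (f x) * of_real (h x) + 0) = 0"
      using cSUP_const[OF ne] by metis
    moreover have small: "cmod (of_real (g x) * of_real (h x) + - of_real (g x)) \<le> \<epsilon> / 2" for x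
    proof -
      have "g x * (1 - h x) \<le> \<epsilon> / 2"
      proof (cases "g x \<le> \<epsilon> / 2")
        case True
        then have "g x * (1 - h x) \<le> \<epsilon> / 2 * 1"
          using g(2) h01 that by (intro mult_mono) auto
        then show ?thesis by simp
      next
        case False
        then have "h x = 1"
          using that by (simp add: h_def field_simps)
        then show ?thesis
          using that by simp
      qed
      moreover have "of_real (g x) * of_real (h x) + - of_real (g x) = - complex_of_real (g x * (1 - h x))"
        by (simp add: algebra_simps)
      moreover have "0 \<le> g x * (1 - h x)"
        using g(2) h01 by simp
      ultimately show ?thesis
        by (metis abs_of_nonneg norm_minus_cancel norm_of_real)
    qed
    have "sup_norm X (\<lambda>x. of_real (g x) * of_real (h x) + - of_real (g x)) \<le> \<epsilon> / 2"
      by (rule cSUP_least[OF ne]) (rule small)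
    moreover have "0 \<le> sup_norm X (\<lambda>x. of_real (g x) * of_real (h x) + - of_real (g x))"
    proof -
      obtain x where "x \<in> topspace X" using ne by blast
      then show ?thesis
        using small by (intro cSUP_upper2[where x = x] bdd_aboveI2[where M = "\<epsilon> / 2"]) auto
    qed
    ultimately show ?thesis
      using that h01 continuous_map_complex_of_real[OF h]
      by (intro exI[of _ "\<lambda>x. of_real (h x)"]) auto
  qed
  then obtain h where h: "continuous_map X euclidean h"
    "sup_norm X (\<lambda>x. of_real (f x) * h x + 0) = 0"
    "sup_norm X (\<lambda>x. of_real (g x) * h x + - of_real (g x)) = 0"
    using degree1_saturated_realizes_two_conditions[OF sat X ne F _ G G', of "\<lambda>_. 0" 0 0]
    by auto
  have "of_real (f x) * h x + 0 = 0" if "x \<in> topspace X" for x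
    using cmod_le_sup_norm[OF X continuous_map_complex_mult_add[OF F h(1), of "\<lambda>_. 0"] that] h(2)
    by (simp)
  then have "U \<subseteq> {x \<in> topspace X. h x \<in> {0}}"
    by (force simp: U_eq)
  moreover have "closedin X {x \<in> topspace X. h x \<in> {0}}"
    by (rule closedin_continuous_map_preimage[OF h(1)]) simp
  ultimately have clU: "X closure_of U \<subseteq> {x \<in> topspace X. h x \<in> {0}}"
    by (rule closure_of_minimal)
  have "of_real (g x) * h x + - of_real (g x) = 0" if "x \<in> topspace X" for x
    using cmod_le_sup_norm[OF X continuous_map_complex_mult_add[OF G h(1) G'] that] h(3)
    by simp
  then have "V \<subseteq> {x \<in> topspace X. h x \<in> {1}}"
    by (force simp: V_eq)
  moreover have "closedin X {x \<in> topspace X. h x \<in> {1}}"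
    by (rule closedin_continuous_map_preimage[OF h(1)]) simp
  ultimately have clV: "X closure_of V \<subseteq> {x \<in> topspace X. h x \<in> {1}}"
    by (rule closure_of_minimal)
  show ?thesis
    using clU clV by (force simp: disjnt_iff)
qed

section \<open>Spaces with forbidden cozero sets\<close>

lemma ccc_space_if_separable_space:
  assumes "separable_space X"
  shows "ccc_space X"
  unfolding ccc_space_def
proof (intro allI impI, elim conjE)
  fix \<U> assume \<U>: "\<forall>U\<in>\<U>. openin X U \<and> U \<noteq> {}" "pairwise disjnt \<U>"
  obtain C where C: "countable C" "X closure_of C = topspace X"
    using assms unfolding separable_space_def by blast
  have "\<exists>c\<in>C. c \<in> U" if "U \<in> \<U>" for U
  proof -
    have "U \<inter> X closure_of C \<noteq> {}"
      using \<U>(1) that C(2) openin_subset by fastforce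
    then show ?thesis
      using \<U>(1) that openin_Int_closure_of_eq_empty[of X U C] by blast
  qed
  then obtain c where c: "\<And>U. U \<in> \<U> \<Longrightarrow> c U \<in> C \<and> c U \<in> U"
    by metis
  have "inj_on c \<U>"
    using c \<U>(2) by (intro inj_onI) (metis disjnt_iff pairwiseD)
  moreover have "countable (c ` \<U>)"
    using c C(1) by (meson countable_subset image_subsetI)
  ultimately show "countable \<U>"
    using countable_image_inj_on by blast
qed

lemma metrizable_imp_cozero_in_delete:
  assumes "metrizable_space X" "p \<in> topspace X"
  shows "cozero_in X (topspace X - {p})"
proof -
  obtain M d where "Metric_space M d" and X: "X = Metric_space.mtopology M d"
    using assms(1) unfolding metrizable_space_def by blast
  interpret Metric_space M d by fact
  have p: "p \<in> M"
    using assms(2) by (simp add: X)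
  have "continuous_map X euclideanreal (d p)"
    using continuous_on_mdist[of p "metric (M, d)"] p by (simp add: X mtopology_of_def)
  then show ?thesis
    unfolding cozero_in_def by (intro exI[of _ "d p"]) (use p in \<open>auto simp: X\<close>)
qed

text \<open>
  The set \<open>U\<close> is the union of a maximal disjoint family of nonempty cozero sets that avoid \<open>p\<close>.  An open
  set disjoint from \<open>U\<close> with a point other than \<open>p\<close> would contain a further member of the family.
\<close>

lemma ccc_imp_dense_cozero_in_avoiding:
  assumes X: "compact_space X" "Hausdorff_space X" "ccc_space X"
    and p: "p \<in> topspace X"
  obtains U where "cozero_in X U" "p \<notin> U" "\<And>W. openin X W \<Longrightarrow> disjnt U W \<Longrightarrow> W \<subseteq> {p}"
proof -
  define \<F> where "\<F> = {\<U>. (\<forall>U\<in>\<U>. cozero_in X U \<and> U \<noteq> {} \<and> p \<notin> U) \<and> pairwise disjnt \<U>}"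
  have "\<exists>\<U>\<in>\<F>. \<forall>\<V>\<in>\<F>. \<U> \<subseteq> \<V> \<longrightarrow> \<V> = \<U>"
  proof (rule subset_Zorn')
    fix \<C> assume \<C>: "subset.chain \<F> \<C>"
    then have "pairwise disjnt (\<Union>\<C>)"
      by (intro pairwise_chain_Union) (auto simp: subset_chain_def chain_subset_def \<F>_def)
    then show "\<Union>\<C> \<in> \<F>"
      using \<C> by (auto simp: \<F>_def subset_chain_def)
  qed
  then obtain \<U> where \<U>: "\<U> \<in> \<F>" and max: "\<And>\<V>. \<V> \<in> \<F> \<Longrightarrow> \<U> \<subseteq> \<V> \<Longrightarrow> \<V> = \<U>"
    by blast
  show ?thesis
  proof
    have "countable \<U>"
      using X(3) \<U> openin_cozero_in unfolding ccc_space_def \<F>_def by blast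
    then show "cozero_in X (\<Union>\<U>)"
      using \<U> by (intro cozero_in_Union) (auto simp: \<F>_def)
    show "p \<notin> \<Union>\<U>"
      using \<U> by (auto simp: \<F>_def)
    fix W assume W: "openin X W" "disjnt (\<Union>\<U>) W"
    show "W \<subseteq> {p}"
    proof (rule ccontr)
      assume "\<not> W \<subseteq> {p}"
      then obtain w where w: "w \<in> W" "w \<noteq> p"
        by blast
      have "closedin X {w}"
        using w W(1) X(2) openin_subset by (auto simp: closedin_Hausdorff_sing_eq)
      moreover have "openin X (W - {p})"
        using W(1) X(2) p by (simp add: closedin_Hausdorff_sing_eq openin_diff)
      ultimately obtain C where C: "cozero_in X C" "{w} \<subseteq> C" "C \<subseteq> W - {p}"
        using cozero_in_between[OF X(1,2)] w by (metis Diff_iff empty_iff insert_iff singleton_iff subsetI)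
      have dC: "disjnt C U" if "U \<in> \<U>" for U
        using C(3) W(2) that by (auto simp: disjnt_iff)
      have "insert C \<U> \<in> \<F>"
        using \<U> C dC by (auto simp: \<F>_def pairwise_insert disjnt_sym)
      then have "C \<in> \<U>"
        using max by blast
      then show False
        using dC[of C] C(2) by (auto simp: disjnt_iff)
    qed
  qed
qed

text \<open>
  For a cozero set \<open>U\<close> that is not closed, the complement of its closure is clopen, hence cozero.  Adding
  it makes \<open>U\<close> dense, and still misses the points that the closure adds to \<open>U\<close>.
\<close>

lemma Rickart_imp_dense_proper_cozero_in:
  assumes X: "compact_space X" "Hausdorff_space X" "infinite (topspace X)" and R: "Rickart_space X"
  obtains U where "cozero_in X U" "U \<noteq> topspace X" "\<And>W. openin X W \<Longrightarrow> disjnt U W \<Longrightarrow> W = {}"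
proof -
  obtain U p where U: "cozero_in X U" and p: "p \<in> X closure_of U" "p \<notin> U"
    using nonclosed_cozero_in_exists[OF X] .
  have "sigma_compactin X {}"
    unfolding sigma_compactin_def by (intro exI[of _ "{}"]) auto
  then have "openin X (X closure_of U)"
    using R openin_cozero_in[OF U] cozero_in_sigma_compactin[OF X(1) U]
    unfolding Rickart_space_def by (metis disjnt_empty2 openin_empty)
  then have W: "openin X (topspace X - X closure_of U)" "closedin X (topspace X - X closure_of U)"
    by auto
  then obtain C where "cozero_in X C" "topspace X - X closure_of U \<subseteq> C" "C \<subseteq> topspace X - X closure_of U"
    using cozero_in_between[OF X(1,2)] by blast
  then have "cozero_in X (topspace X - X closure_of U)"
    by (metis subset_antisym)
  then have coz: "cozero_in X (U \<union> (topspace X - X closure_of U))"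
    by (rule cozero_in_Un[OF U])
  show ?thesis
  proof (rule that[OF coz])
    show "U \<union> (topspace X - X closure_of U) \<noteq> topspace X"
      using p closure_of_subset_topspace[of X U] by blast
    fix W assume W: "openin X W" "disjnt (U \<union> (topspace X - X closure_of U)) W"
    then have "W \<inter> X closure_of U = {}"
      by (simp add: openin_Int_closure_of_eq_empty disjnt_def Int_commute inf_sup_distrib1)
    then show "W = {}"
      using W openin_subset[OF W(1)] by (auto simp: disjnt_iff)
  qed
qed

text \<open>
  The sets are those where \<open>f y > g z\<close> and \<open>f y < g z\<close>, carried over to \<open>X\<close>.  Here \<open>{f > 0}\<close> and
  \<open>{g > 0}\<close> are cozero sets in the factors that are not closed, with boundary points \<open>p\<close> and \<open>q\<close>.  The
  two axes through \<open>(p, q)\<close> lead into the two sets, and continuity along the axes puts the image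
  of \<open>(p, q)\<close> in both closures.
\<close>

lemma prod_imp_disjnt_cozero_in_common_closure:
  assumes Y: "compact_space Y" "Hausdorff_space Y" "infinite (topspace Y)"
    and Z: "compact_space Z" "Hausdorff_space Z" "infinite (topspace Z)"
    and hom: "X homeomorphic_space prod_topology Y Z"
  obtains U V where "cozero_in X U" "cozero_in X V" "disjnt U V"
    "\<not> disjnt (X closure_of U) (X closure_of V)"
proof -
  obtain A p where A: "cozero_in Y A" and p: "p \<in> Y closure_of A" "p \<notin> A"
    using nonclosed_cozero_in_exists[OF Y] .
  obtain B q where B: "cozero_in Z B" and q: "q \<in> Z closure_of B" "q \<notin> B"
    using nonclosed_cozero_in_exists[OF Z] .
  obtain f where f: "continuous_map Y euclideanreal f" "\<And>y. 0 \<le> f y" "A = {y \<in> topspace Y. 0 < f y}"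
    using cozero_in_nonneg[OF A] by metis
  obtain g where g: "continuous_map Z euclideanreal g" "\<And>z. 0 \<le> g z" "B = {z \<in> topspace Z. 0 < g z}"
    using cozero_in_nonneg[OF B] by metis
  have p': "p \<in> topspace Y" "f p = 0" and q': "q \<in> topspace Z" "g q = 0"
    using p q f(2)[of p] g(2)[of q] closure_of_subset_topspace[of Y A] closure_of_subset_topspace[of Z B]
    by (auto simp: f(3) g(3))
  obtain h k where h: "continuous_map X (prod_topology Y Z) h"
    and k: "continuous_map (prod_topology Y Z) X k"
    and hk: "\<And>w. w \<in> topspace (prod_topology Y Z) \<Longrightarrow> h (k w) = w"
    using hom unfolding homeomorphic_space_def homeomorphic_maps_def by blast
  have fh: "continuous_map X euclideanreal (\<lambda>x. f (fst (h x)))"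
    using continuous_map_compose[OF continuous_map_compose[OF h continuous_map_fst] f(1)]
    by (simp add: o_def)
  have gh: "continuous_map X euclideanreal (\<lambda>x. g (snd (h x)))"
    using continuous_map_compose[OF continuous_map_compose[OF h continuous_map_snd] g(1)]
    by (simp add: o_def)
  let ?U = "{x \<in> topspace X. 0 < f (fst (h x)) - g (snd (h x))}"
  let ?V = "{x \<in> topspace X. 0 < g (snd (h x)) - f (fst (h x))}"
  have k_in: "k (y, z) \<in> topspace X" if "y \<in> topspace Y" "z \<in> topspace Z" for y z
    using continuous_map_image_subset_topspace[OF k] that by auto
  have "k (p, q) \<in> X closure_of ?U"
  proof -
    have cont: "continuous_map Y X (\<lambda>y. k (y, q))"
      using continuous_map_compose[OF _ k, of Y "\<lambda>y. (y, q)"] q'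
      by (simp add: o_def continuous_map_pairedI)
    have "(\<lambda>y. k (y, q)) ` A \<subseteq> ?U"
      using q' by (auto simp: f(3) hk k_in)
    then have "(\<lambda>y. k (y, q)) ` (Y closure_of A) \<subseteq> X closure_of ?U"
      by (rule subset_trans[OF continuous_map_image_closure_subset[OF cont] closure_of_mono])
    then show ?thesis
      using p(1) by blast
  qed
  moreover have "k (p, q) \<in> X closure_of ?V"
  proof -
    have cont: "continuous_map Z X (\<lambda>z. k (p, z))"
      using continuous_map_compose[OF _ k, of Z "\<lambda>z. (p, z)"] p'
      by (simp add: o_def continuous_map_pairedI)
    have "(\<lambda>z. k (p, z)) ` B \<subseteq> ?V"
      using p' by (auto simp: g(3) hk k_in)
    then have "(\<lambda>z. k (p, z)) ` (Z closure_of B) \<subseteq> X closure_of ?V"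
      by (rule subset_trans[OF continuous_map_image_closure_subset[OF cont] closure_of_mono])
    then show ?thesis
      using q(1) by blast
  qed
  ultimately have "\<not> disjnt (X closure_of ?U) (X closure_of ?V)"
    by (auto simp: disjnt_iff)
  moreover have "cozero_in X ?U" "cozero_in X ?V"
    unfolding cozero_in_def using fh gh by (blast intro: continuous_map_diff)+
  moreover have "disjnt ?U ?V"
    by (auto simp: disjnt_iff)
  ultimately show ?thesis
    using that by blast
qed

theorem lemma5p12:
  fixes X :: "'a topology"
  assumes "compact_space X" and "Hausdorff_space X" and "infinite (topspace X)"
    and "ccc_space X
       \<or> separable_space X
       \<or> metrizable_space X
       \<or> (\<exists>(Y :: 'b topology) (Z :: 'c topology).
            compact_space Y \<and> Hausdorff_space Y \<and> infinite (topspace Y) \<and>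
            compact_space Z \<and> Hausdorff_space Z \<and> infinite (topspace Z) \<and>
            X homeomorphic_space prod_topology Y Z)
       \<or> \<not> sub_Stonean_space X
       \<or> Rickart_space X"
  shows "\<not> countably_degree1_saturated (C_algebra X)"
proof
  assume sat: "countably_degree1_saturated (C_algebra X)"
  note X = assms(1-3)
  note not_dense = degree1_saturated_imp_not_dense[OF sat X(1)]
    and disjnt_closures = degree1_saturated_imp_disjnt_closures[OF sat X(1)]
  obtain p where p: "p \<in> topspace X" "\<not> openin X {p}"
    using nonisolated_point_exists[OF X(1,3)] .
  \<comment> \<open>A set that avoids \<open>p\<close> is dense as soon as it is dense in the complement of \<open>p\<close>, because \<open>p\<close> is
    not isolated.\<close>
  have avoid: False
    if U: "cozero_in X U" "p \<notin> U" "\<And>W. openin X W \<Longrightarrow> disjnt U W \<Longrightarrow> W \<subseteq> {p}" for U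
    using not_dense[OF U(1)] U(2,3) p by (metis subset_singletonD)
  have ccc: False if "ccc_space X"
    using ccc_imp_dense_cozero_in_avoiding[OF X(1,2) that p(1)] avoid by metis
  consider "ccc_space X" | "separable_space X" | "metrizable_space X"
    | Y Z where "compact_space (Y :: 'b topology)" "Hausdorff_space Y" "infinite (topspace Y)"
      "compact_space (Z :: 'c topology)" "Hausdorff_space Z" "infinite (topspace Z)"
      "X homeomorphic_space prod_topology Y Z"
    | "\<not> sub_Stonean_space X" | "Rickart_space X"
    using assms(4) by blast
  then show False
  proof cases
    case 1
    then show ?thesis by (rule ccc)
  next
    case 2
    then show ?thesis by (rule ccc[OF ccc_space_if_separable_space])
  next
    case 3
    show ?thesis
    proof (rule avoid[OF metrizable_imp_cozero_in_delete[OF 3 p(1)]])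
      show "W \<subseteq> {p}" if "openin X W" "disjnt (topspace X - {p}) W" for W
        using that openin_subset by (fastforce simp: disjnt_iff)
    qed simp
  next
    case 4
    then show ?thesis
      using prod_imp_disjnt_cozero_in_common_closure[OF 4] disjnt_closures by metis
  next
    case 5
    then show ?thesis
      using sigma_compactin_imp_cozero_in[OF X(1,2)] disjnt_closures
      unfolding sub_Stonean_space_def by blast
  next
    case 6
    then show ?thesis
      using Rickart_imp_dense_proper_cozero_in[OF X 6] not_dense by metis
  qed
qed

end
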